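(* Let $P\in\mathbb{C}[X]$ be a polynomial, let $\Lambda$ be the set of roots of $P$ in $[0,4]$, and assume: (i) $0\in\Lambda$; (ii) $4\notin\Lambda$; (iii) the roots of $P$ in $[0,4]$ are simple; (iv) $\delta:\mathbb{N}^*\to\,]0,\infty[$ is a function such that $$\forall\lambda\in\Lambda,\ \forall q\in\mathbb{N}^*,\ \forall\,1\le p\le q-1,\qquad 0<\delta_q\le\left|\lambda-4\sin^2\left(\frac\pi2\frac pq\right)\right|.$$ Then the sequence of matrices $(P(\mathbf{A}_N))_{N\ge1}$ is stable relatively to the sequence $\eta_N=\frac1{\delta_{N+1}}$.
   Context: $\mathbb{N}^*=\{1,2,\dots\}$. For $N\ge1$, $\mathbf{A}_N\in\mathbb{C}^{N\times N}$ is the tridiagonal matrix with diagonal entries $2$ and sub- and super-diagonal entries $-1$ (all other entries $0$). A sequence $(\mathbf{D}_N)_{N\ge1}$, $\mathbf{D}_N\in\mathbb{C}^{N\times N}$, is stable relatively to a sequence $(\eta_N)_{N\ge1}$ of positive numbers if there is $c>0$ such that for all $N\ge1$ and all $\mathbf{v}\in\mathbb{C}^N$, $c\|\mathbf{v}\|_\infty\le\eta_N\|\mathbf{D}_N\mathbf{v}\|_\infty$. *)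

theory Defs
  imports
    Complex_Main
    "Jordan_Normal_Form.Matrix"
    "HOL-Computational_Algebra.Polynomial"
begin

definition lap_mat :: "nat \<Rightarrow> complex mat" where
  "lap_mat N = mat N N (\<lambda>(i, j).
     if i = j then 2 else if i = Suc j \<or> j = Suc i then -1 else 0)"

text \<open>Evaluation of a polynomial at a square matrix, written entrywise as there is no big sum of
  matrices whose dimension is not fixed by the type.  The power
  \<^term>\<open>A ^\<^sub>m 0\<close> is the identity matrix.\<close>

definition poly_mat :: "'a::comm_semiring_1 poly \<Rightarrow> 'a mat \<Rightarrow> 'a mat" where
  "poly_mat p A = mat (dim_row A) (dim_row A) (\<lambda>(i, j).
     \<Sum>k\<le>Polynomial.degree p. Polynomial.coeff p k * (A ^\<^sub>m k) $$ (i, j))"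

text \<open>The element \<open>0\<close> only matters for the vector of dimension \<open>0\<close>.\<close>

definition max_norm_vec :: "complex vec \<Rightarrow> real" where
  "max_norm_vec v = Max (insert 0 ((\<lambda>i. cmod (v $ i)) ` {..<dim_vec v}))"

text \<open>Sequences are indexed by \<open>N \<ge> 1\<close>; the values at \<open>N = 0\<close> are irrelevant.\<close>

definition stable_relatively :: "(nat \<Rightarrow> complex mat) \<Rightarrow> (nat \<Rightarrow> real) \<Rightarrow> bool" where
  "stable_relatively D \<eta> \<longleftrightarrow>
     (\<forall>N\<ge>1. D N \<in> carrier_mat N N \<and> 0 < \<eta> N) \<and>
     (\<exists>c>0. \<forall>N\<ge>1. \<forall>v\<in>carrier_vec N.
        c * max_norm_vec v \<le> \<eta> N * max_norm_vec (D N *\<^sub>v v))"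

end

theory Submission
  imports Defs "HOL-Computational_Algebra.Fundamental_Theorem_Algebra"
begin

text \<open>Write \<open>A\<close> for the matrix of dimension \<open>N\<close>, whose eigenvalues are \<open>4 sin\<^sup>2 (\<pi> p / (2 (N + 1)))\<close> for
  \<open>1 \<le> p \<le> N\<close>.  Over the complex numbers \<open>P\<close> is a product of linear factors \<open>X - \<mu>\<close>, and the
  inverse of \<open>A - \<mu>\<close>, where it exists, is explicit.  If \<open>s\<close> is a nonzero solution of
  \<open>s (k + 2) = (2 - \<mu>) s (k + 1) - s k\<close> with \<open>s 0 = 0\<close>, then the entries of the inverse are
  \<open>s i s (N + 1 - j) / (s 1 s (N + 1))\<close> for \<open>i \<le> j\<close>, and symmetrically otherwise
  (\<open>green_identity\<close>).  The row sums of this Green function behave in three ways.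

  Off \<open>[0, 4]\<close> the solution grows exponentially and the inverse is bounded uniformly in \<open>N\<close>
  (\<open>stable_shifted_lap_mat_outside\<close>).  In \<open>]0, 4[\<close>, with \<open>\<mu> = 2 - 2 cos \<theta>\<close>, the solution is \<open>sin (k \<theta>)\<close>
  and the norm of the inverse is at most of order \<open>N / \<bar>sin ((N + 1) \<theta>)\<bar>\<close>; the denominator is
  comparable to \<open>N + 1\<close> times the distance from \<open>\<theta>\<close> to the grid of the \<open>p \<pi> / (N + 1)\<close>, and hence at
  least of order \<open>(N + 1) \<delta> (N + 1)\<close> (\<open>stable_shifted_lap_mat_interior\<close>).  At \<open>0\<close> the solution is \<open>k\<close>,
  the norm is of order \<open>N\<^sup>2\<close>, and the hypothesis for \<open>p = 1\<close> gives \<open>\<delta> (N + 1) \<le> \<pi>\<^sup>2 / (N + 1)\<^sup>2\<close>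
  (\<open>stable_shifted_lap_mat_0\<close>).  So every factor is stable at the rate \<open>1 / \<delta> (N + 1)\<close>, or at a constant
  rate if its root is off the interval.

  Multiplying these estimates would raise \<open>1 / \<delta> (N + 1)\<close> to the number of roots in the interval.
  Since those roots are simple, a Bezout identity, which amounts to a partial fraction
  decomposition of \<open>1 / P\<close>, expresses the inverse of the product by a sum of the inverses of the
  factors, with uniformly bounded coefficients (\<open>stable_poly_mat_mult_nonroot\<close>).  The rate therefore
  occurs only to the first power.\<close>

section \<open>Polynomials evaluated at a matrix\<close>

lemma poly_mat_carrier [simp]: "A \<in> carrier_mat n n \<Longrightarrow> poly_mat p A \<in> carrier_mat n n"
  by (simp add: poly_mat_def)

lemma dim_poly_mat [simp]:
  "dim_row (poly_mat p A) = dim_row A" "dim_col (poly_mat p A) = dim_row A"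
  by (simp_all add: poly_mat_def)

text \<open>Letting the upper limit exceed the degree allows polynomials of different degrees to be
  compared term by term.\<close>

lemma poly_mat_index:
  assumes A: "A \<in> carrier_mat n n" and ij: "i < n" "j < n" and m: "degree p \<le> m"
  shows "poly_mat p A $$ (i, j) = (\<Sum>k\<le>m. coeff p k * (A ^\<^sub>m k) $$ (i, j))"
proof -
  have "poly_mat p A $$ (i, j) = (\<Sum>k\<le>degree p. coeff p k * (A ^\<^sub>m k) $$ (i, j))"
    using A ij by (simp add: poly_mat_def)
  also have "\<dots> = (\<Sum>k\<le>m. coeff p k * (A ^\<^sub>m k) $$ (i, j))"
    using m by (intro sum.mono_neutral_left) (auto simp: coeff_eq_0)
  finally show ?thesis .
qed

lemma poly_mat_0: "A \<in> carrier_mat n n \<Longrightarrow> poly_mat 0 A = 0\<^sub>m n n"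
  by (rule eq_matI) (auto simp: poly_mat_def)

lemma poly_mat_add:
  assumes A: "A \<in> carrier_mat n n"
  shows "poly_mat (p + q) A = poly_mat p A + poly_mat q A"
proof (rule eq_matI, goal_cases)
  case (1 i j)
  let ?m = "max (degree p) (degree q)"
  have "i < n" "j < n" using 1 A by auto
  then show ?case using A degree_add_le_max[of p q]
    by (simp add: poly_mat_index[OF A, of _ _ _ ?m] sum.distrib ring_distribs)
qed (use A in \<open>simp_all add: poly_mat_def\<close>)

lemma poly_mat_smult:
  assumes A: "A \<in> carrier_mat n n"
  shows "poly_mat (smult c p) A = c \<cdot>\<^sub>m poly_mat p A"
proof (rule eq_matI, goal_cases)
  case (1 i j)
  have "i < n" "j < n" using 1 A by auto
  then show ?case using A degree_smult_le[of c p]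
    by (simp add: poly_mat_index[OF A, of _ _ _ "degree p"] sum_distrib_left mult.assoc)
qed (use A in \<open>simp_all add: poly_mat_def\<close>)

text \<open>Horner's rule.  It turns the facts below into inductions over the coefficient list, in which the
  powers of the matrix no longer appear.\<close>

lemma poly_mat_pCons:
  fixes A :: "'a::comm_semiring_1 mat"
  assumes A: "A \<in> carrier_mat n n"
  shows "poly_mat (pCons c p) A = c \<cdot>\<^sub>m 1\<^sub>m n + poly_mat p A * A"
proof (rule eq_matI, goal_cases)
  case (1 i j)
  have ij: "i < n" "j < n" using 1 A by auto
  have car: "A ^\<^sub>m k \<in> carrier_mat n n" for k using A by (rule pow_carrier_mat)
  have "(poly_mat p A * A) $$ (i, j) = (\<Sum>l<n. poly_mat p A $$ (i, l) * A $$ (l, j))"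
    using A ij by (simp add: scalar_prod_def atLeast0LessThan)
  also have "\<dots> = (\<Sum>l<n. (\<Sum>k\<le>degree p. coeff p k * (A ^\<^sub>m k) $$ (i, l)) * A $$ (l, j))"
    using ij by (intro sum.cong) (simp_all add: poly_mat_index[OF A, of _ _ _ "degree p"])
  also have "\<dots> = (\<Sum>k\<le>degree p. coeff p k * (\<Sum>l<n. (A ^\<^sub>m k) $$ (i, l) * A $$ (l, j)))"
    unfolding sum_distrib_right sum_distrib_left by (subst sum.swap) (simp add: mult.assoc)
  also have "\<dots> = (\<Sum>k\<le>degree p. coeff p k * (A ^\<^sub>m Suc k) $$ (i, j))"
    using A ij car by (simp add: scalar_prod_def atLeast0LessThan)
  finally have prod: "(poly_mat p A * A) $$ (i, j) = \<dots>" .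
  have "poly_mat (pCons c p) A $$ (i, j)
      = (\<Sum>k\<le>Suc (degree p). coeff (pCons c p) k * (A ^\<^sub>m k) $$ (i, j))"
    by (rule poly_mat_index[OF A ij degree_pCons_le])
  also have "\<dots> = c * (1\<^sub>m n) $$ (i, j) + (\<Sum>k\<le>degree p. coeff p k * (A ^\<^sub>m Suc k) $$ (i, j))"
    using A by (simp only: sum.atMost_Suc_shift) simp
  finally show ?case
    using prod ij A by simp
qed (use A in \<open>simp_all add: poly_mat_def\<close>)

lemma poly_mat_commute:
  fixes A :: "'a::comm_ring_1 mat"
  assumes A: "A \<in> carrier_mat n n"
  shows "A * poly_mat p A = poly_mat p A * A"
proof (induction p)
  case 0
  then show ?case using A by (simp add: poly_mat_0[OF A])
next
  case (pCons c p)
  have P: "poly_mat p A \<in> carrier_mat n n" using A by simp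
  have "A * poly_mat (pCons c p) A = c \<cdot>\<^sub>m A + A * (poly_mat p A * A)"
    using A P mult_carrier_mat[OF P A] by (simp add: poly_mat_pCons[OF A] mult_add_distrib_mat[of A n n _ n]
      mult_smult_distrib[of A n n _ n])
  also have "A * (poly_mat p A * A) = poly_mat p A * A * A"
    using pCons.IH by (simp add: assoc_mult_mat[OF A P A, symmetric])
  also have "c \<cdot>\<^sub>m A + poly_mat p A * A * A = poly_mat (pCons c p) A * A"
    using A P mult_carrier_mat[OF P A] by (simp add: poly_mat_pCons[OF A]
      add_mult_distrib_mat[of _ n n _ _ n] mult_smult_assoc_mat[of _ n n _ n])
  finally show ?case .
qed

text \<open>Evaluation at a fixed matrix is multiplicative because the matrix commutes with its own
  polynomials.  In particular the order of the factors does not matter, and this is how one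
  stable factor after the other is peeled off in the products below.\<close>

lemma poly_mat_mult:
  fixes A :: "'a::comm_ring_1 mat"
  assumes A: "A \<in> carrier_mat n n"
  shows "poly_mat (p * q) A = poly_mat p A * poly_mat q A"
proof (induction p)
  case 0
  then show ?case using A by (simp add: poly_mat_0[OF A] left_mult_zero_mat[of _ n n])
next
  case (pCons c p)
  have P: "poly_mat p A \<in> carrier_mat n n" and Q: "poly_mat q A \<in> carrier_mat n n" using A by simp_all
  have zero: "0 \<cdot>\<^sub>m 1\<^sub>m n + B = B" if "B \<in> carrier_mat n n" for B :: "'a mat"
    using that by (intro eq_matI) auto
  have "poly_mat (pCons c p * q) A = c \<cdot>\<^sub>m poly_mat q A + poly_mat p A * poly_mat q A * A"
    using A P Q pCons.IH by (simp add: poly_mat_add[OF A] poly_mat_smult[OF A] poly_mat_pCons[OF A]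
        zero[OF mult_carrier_mat[OF mult_carrier_mat[OF P Q] A]])
  also have "poly_mat p A * poly_mat q A * A = poly_mat p A * A * poly_mat q A"
    using poly_mat_commute[OF A, of q] by (simp add: assoc_mult_mat[OF P Q A] assoc_mult_mat[OF P A Q])
  also have "c \<cdot>\<^sub>m poly_mat q A + \<dots> = poly_mat (pCons c p) A * poly_mat q A"
    using A P Q mult_carrier_mat[OF P A] by (simp add: poly_mat_pCons[OF A]
      add_mult_distrib_mat[of _ n n _ _ n] mult_smult_assoc_mat[of _ n n _ n])
  finally show ?case .
qed

lemma poly_mat_mult_mult_vec:
  fixes A :: "'a::comm_ring_1 mat"
  assumes A: "A \<in> carrier_mat n n" and v: "v \<in> carrier_vec n"
  shows "poly_mat (p * q) A *\<^sub>v v = poly_mat p A *\<^sub>v (poly_mat q A *\<^sub>v v)"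
  using A v by (simp add: poly_mat_mult[OF A] assoc_mult_mat_vec[of _ n n _ n])

lemma poly_mat_add_mult_vec:
  fixes A :: "'a::comm_ring_1 mat"
  assumes A: "A \<in> carrier_mat n n" and v: "v \<in> carrier_vec n"
  shows "poly_mat (p + q) A *\<^sub>v v = poly_mat p A *\<^sub>v v + poly_mat q A *\<^sub>v v"
  using A v by (simp add: poly_mat_add[OF A] add_mult_distrib_mat_vec[of _ n n])

lemma poly_mat_pCons_mult_vec:
  fixes A :: "'a::comm_ring_1 mat"
  assumes A: "A \<in> carrier_mat n n" and v: "v \<in> carrier_vec n"
  shows "poly_mat (pCons c p) A *\<^sub>v v = c \<cdot>\<^sub>v v + poly_mat p A *\<^sub>v (A *\<^sub>v v)"
proof -
  have "(c \<cdot>\<^sub>m 1\<^sub>m n) *\<^sub>v v = c \<cdot>\<^sub>v v" using v by (intro eq_vecI) auto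
  then show ?thesis
    using A v by (simp add: poly_mat_pCons[OF A] add_mult_distrib_mat_vec[of _ n n]
        mult_carrier_mat[of _ n n] assoc_mult_mat_vec[of _ n n _ n])
qed

lemma poly_mat_const_mult_vec:
  fixes A :: "'a::comm_ring_1 mat"
  assumes A: "A \<in> carrier_mat n n" and v: "v \<in> carrier_vec n"
  shows "poly_mat [:c:] A *\<^sub>v v = c \<cdot>\<^sub>v v"
proof -
  have "poly_mat 0 A *\<^sub>v (A *\<^sub>v v) = 0\<^sub>v n"
    using A v by (intro eq_vecI) (auto simp: poly_mat_0[OF A])
  then show ?thesis using v by (simp add: poly_mat_pCons_mult_vec[OF A v])
qed

section \<open>The maximum norm\<close>

lemma max_norm_vec_nonneg: "0 \<le> max_norm_vec v"
  by (simp add: max_norm_vec_def)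

lemma cmod_le_max_norm_vec: "i < dim_vec v \<Longrightarrow> cmod (v $ i) \<le> max_norm_vec v"
  by (simp add: max_norm_vec_def)

lemma max_norm_vec_leI:
  "0 \<le> b \<Longrightarrow> (\<And>i. i < dim_vec v \<Longrightarrow> cmod (v $ i) \<le> b) \<Longrightarrow> max_norm_vec v \<le> b"
  by (auto simp: max_norm_vec_def)

lemma max_norm_vec_add_le:
  assumes "v \<in> carrier_vec n" "w \<in> carrier_vec n"
  shows "max_norm_vec (v + w) \<le> max_norm_vec v + max_norm_vec w"
  using assms
  by (intro max_norm_vec_leI add_nonneg_nonneg max_norm_vec_nonneg)
     (auto intro!: order.trans[OF norm_triangle_ineq] add_mono cmod_le_max_norm_vec)

lemma max_norm_vec_smult_le: "max_norm_vec (c \<cdot>\<^sub>v v) \<le> cmod c * max_norm_vec v"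
  by (intro max_norm_vec_leI mult_nonneg_nonneg max_norm_vec_nonneg)
     (auto simp: norm_mult intro!: mult_left_mono cmod_le_max_norm_vec)

lemma max_norm_vec_smult: "max_norm_vec (c \<cdot>\<^sub>v v) = cmod c * max_norm_vec v"
proof (cases "c = 0")
  case True
  then show ?thesis
    using max_norm_vec_smult_le[of c v] max_norm_vec_nonneg[of "c \<cdot>\<^sub>v v"] by simp
next
  case False
  then have "v = inverse c \<cdot>\<^sub>v (c \<cdot>\<^sub>v v)" by (simp add: smult_smult_assoc)
  then have "max_norm_vec v \<le> cmod (inverse c) * max_norm_vec (c \<cdot>\<^sub>v v)"
    by (metis max_norm_vec_smult_le)
  also have "cmod (inverse c) = inverse (cmod c)" by (rule norm_inverse)
  finally have "cmod c * max_norm_vec v \<le> max_norm_vec (c \<cdot>\<^sub>v v)"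
    using False by (simp add: inverse_eq_divide pos_le_divide_eq mult.commute)
  then show ?thesis using max_norm_vec_smult_le[of c v] by simp
qed

section \<open>The discrete Laplacian with Dirichlet boundary values\<close>

lemma lap_mat_carrier [simp]: "lap_mat N \<in> carrier_mat N N"
  by (simp add: lap_mat_def)

text \<open>The vector is read as a sequence indexed by \<open>1, \<dots>, N\<close> that vanishes at \<open>0\<close> and at
  \<open>N + 1\<close>.  This makes the first and last rows of the matrix look like all the others.\<close>

definition dirichlet_ext :: "complex vec \<Rightarrow> nat \<Rightarrow> complex" where
  "dirichlet_ext v k = (if k = 0 \<or> dim_vec v < k then 0 else v $ (k - 1))"

lemma cmod_dirichlet_ext_le: "cmod (dirichlet_ext v k) \<le> max_norm_vec v"
  by (auto simp: dirichlet_ext_def max_norm_vec_nonneg intro!: cmod_le_max_norm_vec)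

lemma lap_mat_mult_vec:
  assumes v: "v \<in> carrier_vec N" and i: "i < N"
  shows "(lap_mat N *\<^sub>v v) $ i
    = 2 * dirichlet_ext v (i + 1) - dirichlet_ext v i - dirichlet_ext v (i + 2)"
proof -
  have "(lap_mat N *\<^sub>v v) $ i
      = (\<Sum>j<N. (if i = j then 2 else if i = Suc j \<or> j = Suc i then -1 else 0) * v $ j)"
    using v i by (simp add: lap_mat_def scalar_prod_def atLeast0LessThan)
  also have "\<dots> = (\<Sum>j<N. (if j = i then 2 * v $ i else 0)
      - (if j = i - 1 then dirichlet_ext v i else 0) - (if j = i + 1 then dirichlet_ext v (i + 2) else 0))"
    using v i by (intro sum.cong) (auto simp: dirichlet_ext_def)
  also have "\<dots> = 2 * v $ i - dirichlet_ext v i - dirichlet_ext v (i + 2)"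
    using v i by (auto simp: sum_subtractf dirichlet_ext_def)
  finally show ?thesis using v i by (simp add: dirichlet_ext_def)
qed

lemma max_norm_vec_lap_mat_le:
  assumes v: "v \<in> carrier_vec N"
  shows "max_norm_vec (lap_mat N *\<^sub>v v) \<le> 4 * max_norm_vec v"
proof (rule max_norm_vec_leI)
  fix i assume "i < dim_vec (lap_mat N *\<^sub>v v)"
  then have i: "i < N" by (simp add: lap_mat_def)
  let ?f = "dirichlet_ext v"
  have "cmod (2 * ?f (i + 1) - ?f i - ?f (i + 2)) \<le> 2 * cmod (?f (i + 1)) + cmod (?f i) + cmod (?f (i + 2))"
    using norm_triangle_ineq4[of "2 * ?f (i + 1) - ?f i" "?f (i + 2)"]
      norm_triangle_ineq4[of "2 * ?f (i + 1)" "?f i"] by (simp add: norm_mult)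
  then show "cmod ((lap_mat N *\<^sub>v v) $ i) \<le> 4 * max_norm_vec v"
    using cmod_dirichlet_ext_le[of v i] cmod_dirichlet_ext_le[of v "i + 1"]
      cmod_dirichlet_ext_le[of v "i + 2"]
    unfolding lap_mat_mult_vec[OF v i] by linarith
qed (simp add: max_norm_vec_nonneg)

text \<open>The entries of a row have absolute sum at most \<open>4\<close>, whatever the dimension, so the operator norm
  of a fixed polynomial is bounded by a constant independent of \<open>N\<close>.  This controls the Bezout
  cofactor in the product of stable factors.\<close>

lemma poly_mat_lap_mat_bounded:
  "\<exists>C\<ge>0. \<forall>N. \<forall>v\<in>carrier_vec N. max_norm_vec (poly_mat p (lap_mat N) *\<^sub>v v) \<le> C * max_norm_vec v"
proof (induction p)
  case 0
  have "max_norm_vec (0\<^sub>m N N *\<^sub>v v) \<le> 0" if "v \<in> carrier_vec N" for N :: nat and v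
    using that by (intro max_norm_vec_leI) auto
  then show ?case by (intro exI[of _ 0]) (simp add: poly_mat_0[OF lap_mat_carrier])
next
  case (pCons c p)
  then obtain C where C: "C \<ge> 0"
    "\<And>N v. v \<in> carrier_vec N \<Longrightarrow> max_norm_vec (poly_mat p (lap_mat N) *\<^sub>v v) \<le> C * max_norm_vec v"
    by blast
  have "max_norm_vec (poly_mat (pCons c p) (lap_mat N) *\<^sub>v v) \<le> (cmod c + C * 4) * max_norm_vec v"
    if v: "v \<in> carrier_vec N" for N v
  proof -
    let ?A = "lap_mat N"
    have Av: "?A *\<^sub>v v \<in> carrier_vec N" by (rule mult_mat_vec_carrier[OF lap_mat_carrier v])
    have PAv: "poly_mat p ?A *\<^sub>v (?A *\<^sub>v v) \<in> carrier_vec N"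
      by (rule mult_mat_vec_carrier[OF poly_mat_carrier[OF lap_mat_carrier] Av])
    have "max_norm_vec (poly_mat (pCons c p) ?A *\<^sub>v v)
        \<le> max_norm_vec (c \<cdot>\<^sub>v v) + max_norm_vec (poly_mat p ?A *\<^sub>v (?A *\<^sub>v v))"
      using v PAv by (simp add: poly_mat_pCons_mult_vec[OF lap_mat_carrier v] max_norm_vec_add_le[of _ N])
    also have "\<dots> \<le> cmod c * max_norm_vec v + C * (4 * max_norm_vec v)"
      using max_norm_vec_lap_mat_le[OF v] C(1)
      by (intro add_mono eq_refl[OF max_norm_vec_smult] order.trans[OF C(2)[OF Av]] mult_left_mono)
    finally show ?thesis by (simp add: algebra_simps)
  qed
  then show ?case using C(1) by (intro exI[of _ "cmod c + C * 4"]) auto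
qed

section \<open>The Green function of a three-term recurrence\<close>

text \<open>Summation by parts: the recurrence is self-adjoint, so pairing a solution \<open>s\<close> with the residual of
  an arbitrary sequence \<open>f\<close> telescopes to their discrete Wronskian at \<open>j\<close>.\<close>

lemma recurrence_partial_sum:
  fixes s f :: "nat \<Rightarrow> 'a::comm_ring_1"
  assumes s0: "s 0 = 0" and rec: "\<And>k. s (k + 2) = \<tau> * s (k + 1) - s k" and f0: "f 0 = 0"
  shows "(\<Sum>i<j. s (i + 1) * (\<tau> * f (i + 1) - f i - f (i + 2))) = s (j + 1) * f j - s j * f (j + 1)"
proof (induction j)
  case (Suc j)
  have "s (Suc (Suc j)) = \<tau> * s (Suc j) - s j" using rec[of j] by simp
  then show ?case unfolding sum.lessThan_Suc Suc.IH
    by (simp only: add_2_eq_Suc' Suc_eq_plus1[symmetric]) (simp add: algebra_simps)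
qed (simp add: s0 f0)

text \<open>The addition formula of the solutions.  For \<open>s k = sin (k \<theta>)\<close> it is the familiar
  \<open>sin ((j + 1) \<theta>) sin ((m + 1) \<theta>) - sin (j \<theta>) sin (m \<theta>) = sin \<theta> sin ((j + m + 1) \<theta>)\<close>.\<close>

lemma recurrence_wronskian:
  fixes s :: "nat \<Rightarrow> 'a::comm_ring_1"
  assumes s0: "s 0 = 0" and rec: "\<And>k. s (k + 2) = \<tau> * s (k + 1) - s k"
  shows "s (j + 1) * s (m + 1) - s j * s m = s 1 * s (j + m + 1)"
proof (induction j arbitrary: m)
  case (Suc j)
  have "s (Suc j + 1) * s (m + 1) - s (Suc j) * s m = s (j + 1) * s (Suc m + 1) - s j * s (Suc m)"
    using rec[of j, simplified] rec[of m, simplified]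
    by (simp only: Suc_eq_plus1[symmetric]) (simp add: algebra_simps)
  then show ?case using Suc.IH[of "Suc m"] by (simp add: algebra_simps)
qed (simp add: s0)

text \<open>The Green function of the Dirichlet problem on \<open>1, \<dots>, N\<close>, built from the solution \<open>s\<close> vanishing at
  the left end and its mirror image \<open>k \<mapsto> s (N + 1 - k)\<close> vanishing at the right end.  Summing
  the residual \<open>w\<close> against \<open>s\<close> from the left, and against the mirror image from the right, gives two
  Wronskians; eliminating the neighbouring value \<open>f (j + 1)\<close> leaves a multiple of \<open>f j\<close>.\<close>

lemma green_identity:
  fixes s f :: "nat \<Rightarrow> 'a::comm_ring_1"
  assumes s0: "s 0 = 0" and rec: "\<And>k. s (k + 2) = \<tau> * s (k + 1) - s k"
    and f0: "f 0 = 0" and fN: "f (N + 1) = 0" and j: "j \<le> N"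
  defines "w \<equiv> \<lambda>i. \<tau> * f (i + 1) - f i - f (i + 2)"
  shows "s 1 * s (N + 1) * f j
    = s (N + 1 - j) * (\<Sum>i<j. s (i + 1) * w i) + s j * (\<Sum>i<N - j. s (i + 1) * w (N - 1 - i))"
proof -
  \<comment> \<open>The sum over the indices to the right of \<open>j\<close> is a left sum for the reflected sequence.\<close>
  define g where "g = (\<lambda>i. f (N + 1 - i))"
  have "(\<Sum>i<N - j. s (i + 1) * w (N - 1 - i))
      = (\<Sum>i<N - j. s (i + 1) * (\<tau> * g (i + 1) - g i - g (i + 2)))"
  proof (rule sum.cong, goal_cases)
    case (2 i)
    then have "N - 1 - i + 1 = N - i" "N - 1 - i + 2 = N + 1 - i" "N + 1 - (i + 2) = N - 1 - i"
      by auto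
    then show ?case by (simp add: w_def g_def algebra_simps)
  qed simp
  also have "\<dots> = s (N - j + 1) * g (N - j) - s (N - j) * g (N - j + 1)"
    by (rule recurrence_partial_sum[where s = s and f = g, OF s0 rec]) (simp add: g_def fN[simplified])
  also have "\<dots> = s (N + 1 - j) * f (j + 1) - s (N - j) * f j"
    using j by (simp add: g_def Suc_diff_le)
  finally have right: "(\<Sum>i<N - j. s (i + 1) * w (N - 1 - i)) = \<dots>" .
  have left: "(\<Sum>i<j. s (i + 1) * w i) = s (j + 1) * f j - s j * f (j + 1)"
    unfolding w_def by (rule recurrence_partial_sum[where s = s and f = f, OF s0 rec f0])
  have "s (j + 1) * s (N + 1 - j) - s j * s (N - j) = s 1 * s (N + 1)"
    using recurrence_wronskian[where s = s, OF s0 rec, of j "N - j"] j by (simp add: Suc_diff_le)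
  then have "s 1 * s (N + 1) * f j = (s (j + 1) * s (N + 1 - j) - s j * s (N - j)) * f j"
    by simp
  then show ?thesis unfolding left right by (simp add: algebra_simps)
qed

lemma shifted_lap_mat_mult_vec:
  assumes v: "v \<in> carrier_vec N" and i: "i < N"
  shows "(poly_mat [:- \<mu>, 1:] (lap_mat N) *\<^sub>v v) $ i
    = (2 - \<mu>) * dirichlet_ext v (i + 1) - dirichlet_ext v i - dirichlet_ext v (i + 2)"
proof -
  have Av: "lap_mat N *\<^sub>v v \<in> carrier_vec N" by (rule mult_mat_vec_carrier[OF lap_mat_carrier v])
  have one: "1 \<cdot>\<^sub>v u = u" for u :: "complex vec" by (intro eq_vecI) auto
  have "poly_mat [:- \<mu>, 1:] (lap_mat N) *\<^sub>v v = - \<mu> \<cdot>\<^sub>v v + lap_mat N *\<^sub>v v"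
    by (simp add: poly_mat_pCons_mult_vec[OF lap_mat_carrier v]
        poly_mat_const_mult_vec[OF lap_mat_carrier Av] one)
  also have "\<dots> $ i = - \<mu> * v $ i + (lap_mat N *\<^sub>v v) $ i"
    using v i Av carrier_vecD[OF Av] index_add_vec(1) index_smult_vec(1) by (metis carrier_vecD)
  finally have "(poly_mat [:- \<mu>, 1:] (lap_mat N) *\<^sub>v v) $ i
      = - \<mu> * v $ i + (lap_mat N *\<^sub>v v) $ i" .
  moreover have "dirichlet_ext v (i + 1) = v $ i"
    using v i by (simp add: dirichlet_ext_def)
  ultimately show ?thesis unfolding lap_mat_mult_vec[OF v i] by (simp add: algebra_simps)
qed

text \<open>The row sums of the absolute Green function bound the inverse of the shifted matrix in the
  maximum norm.  The normalising factor is kept on the left, so that the estimate makes sense also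
  where it vanishes, that is, at an eigenvalue.\<close>

lemma shifted_lap_mat_bound:
  fixes s :: "nat \<Rightarrow> complex"
  assumes s0: "s 0 = 0" and rec: "\<And>k. s (k + 2) = (2 - \<mu>) * s (k + 1) - s k"
    and v: "v \<in> carrier_vec N"
    and M0: "0 \<le> M" and M: "\<And>j. 1 \<le> j \<Longrightarrow> j \<le> N \<Longrightarrow>
      cmod (s (N + 1 - j)) * (\<Sum>i<j. cmod (s (i + 1))) + cmod (s j) * (\<Sum>i<N - j. cmod (s (i + 1))) \<le> M"
  shows "cmod (s 1) * cmod (s (N + 1)) * max_norm_vec v
    \<le> M * max_norm_vec (poly_mat [:- \<mu>, 1:] (lap_mat N) *\<^sub>v v)"
proof -
  define W where "W = max_norm_vec (poly_mat [:- \<mu>, 1:] (lap_mat N) *\<^sub>v v)"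
  define f where "f = dirichlet_ext v"
  define w where "w = (\<lambda>i. (2 - \<mu>) * f (i + 1) - f i - f (i + 2))"
  have dim: "dim_vec (poly_mat [:- \<mu>, 1:] (lap_mat N) *\<^sub>v v) = N" by (simp add: lap_mat_def)
  have w: "cmod (w i) \<le> W" if "i < N" for i
    using cmod_le_max_norm_vec[of i "poly_mat [:- \<mu>, 1:] (lap_mat N) *\<^sub>v v"] that
    unfolding shifted_lap_mat_mult_vec[OF v that] dim by (simp add: w_def W_def f_def)
  have W0: "W \<ge> 0" by (simp add: W_def max_norm_vec_nonneg)
  have sum_le: "cmod (\<Sum>i<m. s (i + 1) * w (h i)) \<le> (\<Sum>i<m. cmod (s (i + 1))) * W"
    if "\<And>i. i < m \<Longrightarrow> h i < N" for m h
    unfolding sum_distrib_right using that w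
    by (intro sum_norm_le) (auto simp: norm_mult intro!: mult_left_mono)
  have entry: "cmod (s 1) * cmod (s (N + 1)) * cmod (v $ k) \<le> M * W" if k: "k < N" for k
  proof -
    let ?j = "k + 1"
    let ?L = "\<Sum>i<?j. s (i + 1) * w i" and ?R = "\<Sum>i<N - ?j. s (i + 1) * w (N - 1 - i)"
    have "s 1 * s (N + 1) * f ?j = s (N + 1 - ?j) * ?L + s ?j * ?R"
      unfolding w_def using v k
      by (intro green_identity[where s = s and f = f, OF s0 rec]) (auto simp: f_def dirichlet_ext_def)
    moreover have "f ?j = v $ k" using v k by (simp add: f_def dirichlet_ext_def)
    ultimately have "cmod (s 1) * cmod (s (N + 1)) * cmod (v $ k) = cmod (s (N + 1 - ?j) * ?L + s ?j * ?R)"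
      by (simp only: norm_mult[symmetric])
    also have "\<dots> \<le> cmod (s (N + 1 - ?j)) * cmod ?L + cmod (s ?j) * cmod ?R"
      unfolding norm_mult[symmetric] by (rule norm_triangle_ineq)
    also have "\<dots> \<le> cmod (s (N + 1 - ?j)) * ((\<Sum>i<?j. cmod (s (i + 1))) * W)
        + cmod (s ?j) * ((\<Sum>i<N - ?j. cmod (s (i + 1))) * W)"
      using k by (intro add_mono mult_left_mono sum_le) auto
    also have "\<dots> = (cmod (s (N + 1 - ?j)) * (\<Sum>i<?j. cmod (s (i + 1)))
        + cmod (s ?j) * (\<Sum>i<N - ?j. cmod (s (i + 1)))) * W"
      by (simp add: algebra_simps)
    also have "\<dots> \<le> M * W"
      using k W0 by (intro mult_right_mono M) auto
    finally show ?thesis .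
  qed
  show ?thesis
  proof (cases "cmod (s 1) * cmod (s (N + 1)) = 0")
    case True
    then have "cmod (s 1) * cmod (s (N + 1)) * max_norm_vec v = 0" by (simp only: mult_zero_left)
    also have "0 \<le> M * W" using W0 M0 by simp
    finally show ?thesis by (simp only: W_def)
  next
    case False
    then have pos: "cmod (s 1) * cmod (s (N + 1)) > 0" by simp
    then have "max_norm_vec v \<le> M * W / (cmod (s 1) * cmod (s (N + 1)))"
      using entry v W0 M0 by (intro max_norm_vec_leI) (auto simp: pos_le_divide_eq mult.commute)
    then show ?thesis using pos by (simp add: pos_le_divide_eq mult.commute W_def)
  qed
qed

lemma stable_shifted_lap_mat:
  fixes s :: "nat \<Rightarrow> complex"
  assumes s0: "s 0 = 0" and s1: "s 1 \<noteq> 0" and rec: "\<And>k. s (k + 2) = (2 - \<mu>) * s (k + 1) - s k"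
    and \<eta>: "\<And>N. 1 \<le> N \<Longrightarrow> 0 < \<eta> N" and K: "0 < K"
    and nz: "\<And>N. 1 \<le> N \<Longrightarrow> s (N + 1) \<noteq> 0"
    and le: "\<And>N j. 1 \<le> j \<Longrightarrow> j \<le> N \<Longrightarrow>
      cmod (s (N + 1 - j)) * (\<Sum>i<j. cmod (s (i + 1))) + cmod (s j) * (\<Sum>i<N - j. cmod (s (i + 1)))
      \<le> K * \<eta> N * cmod (s (N + 1))"
  shows "stable_relatively (\<lambda>N. poly_mat [:- \<mu>, 1:] (lap_mat N)) \<eta>"
  unfolding stable_relatively_def
proof (intro conjI allI impI exI ballI)
  show "0 < cmod (s 1) / K" using s1 K by simp
  fix N :: nat and v :: "complex vec" assume N: "1 \<le> N" and v: "v \<in> carrier_vec N"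
  let ?W = "max_norm_vec (poly_mat [:- \<mu>, 1:] (lap_mat N) *\<^sub>v v)"
  have pos: "0 < cmod (s (N + 1))" using nz[OF N] by simp
  have "cmod (s 1) * cmod (s (N + 1)) * max_norm_vec v \<le> K * \<eta> N * cmod (s (N + 1)) * ?W"
    using K \<eta>[OF N] by (intro shifted_lap_mat_bound[where s = s, OF s0 rec v _ le]) auto
  then have "cmod (s (N + 1)) * (cmod (s 1) * max_norm_vec v) \<le> cmod (s (N + 1)) * (K * (\<eta> N * ?W))"
    by (simp add: algebra_simps)
  then have "cmod (s 1) * max_norm_vec v \<le> K * (\<eta> N * ?W)"
    using pos by (simp add: mult_le_cancel_left_pos)
  then show "cmod (s 1) / K * max_norm_vec v \<le> \<eta> N * ?W"
    using K by (simp add: field_simps)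
qed (simp_all add: \<eta>)

text \<open>The crude form of the criterion, estimating every value of the solution by a common bound.  It
  loses no more than a constant factor when \<open>s\<close> does not grow exponentially, which is the case for
  \<open>\<mu>\<close> in \<open>[0, 4]\<close>.\<close>

lemma stable_shifted_lap_mat_bounded:
  fixes s :: "nat \<Rightarrow> complex"
  assumes s0: "s 0 = 0" and s1: "s 1 \<noteq> 0" and rec: "\<And>k. s (k + 2) = (2 - \<mu>) * s (k + 1) - s k"
    and \<eta>: "\<And>N. 1 \<le> N \<Longrightarrow> 0 < \<eta> N" and K: "0 < K"
    and nz: "\<And>N. 1 \<le> N \<Longrightarrow> s (N + 1) \<noteq> 0"
    and M: "\<And>N k. k \<le> N \<Longrightarrow> cmod (s k) \<le> M N"
    and le: "\<And>N. 1 \<le> N \<Longrightarrow> real N * (M N)\<^sup>2 \<le> K * \<eta> N * cmod (s (N + 1))"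
  shows "stable_relatively (\<lambda>N. poly_mat [:- \<mu>, 1:] (lap_mat N)) \<eta>"
proof (rule stable_shifted_lap_mat[where s = s, OF s0 s1 rec \<eta> K nz])
  fix N j :: nat assume j: "1 \<le> j" "j \<le> N"
  have M0: "0 \<le> M N" using M[of 0 N] by (simp add: s0)
  have sum_le: "(\<Sum>i<m. cmod (s (i + 1))) \<le> real m * M N" if "m \<le> N" for m
    using sum_bounded_above[of "{..<m}" "\<lambda>i. cmod (s (i + 1))" "M N"] M that by simp
  have "cmod (s (N + 1 - j)) * (\<Sum>i<j. cmod (s (i + 1))) + cmod (s j) * (\<Sum>i<N - j. cmod (s (i + 1)))
      \<le> M N * (real j * M N) + M N * (real (N - j) * M N)"
    using j M0 by (intro add_mono mult_mono M sum_le sum_nonneg) auto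
  also have "\<dots> = real N * (M N)\<^sup>2"
    using j by (simp add: of_nat_diff power2_eq_square algebra_simps)
  also have "\<dots> \<le> K * \<eta> N * cmod (s (N + 1))" using j by (intro le) simp
  finally show "cmod (s (N + 1 - j)) * (\<Sum>i<j. cmod (s (i + 1)))
      + cmod (s j) * (\<Sum>i<N - j. cmod (s (i + 1))) \<le> \<dots>" .
qed auto

section \<open>Points outside the spectral interval\<close>

text \<open>The characteristic equation \<open>z\<^sup>2 - (2 - \<mu>) z + 1 = 0\<close> of the recurrence has roots with product
  \<open>1\<close>.  Both lie on the unit circle only if their sum \<open>2 - \<mu>\<close> is real and in \<open>[-2, 2]\<close>.\<close>

lemma two_minus_eq_add_inverse:
  fixes \<mu> :: complex
  assumes "\<not> (\<exists>x::real. 0 \<le> x \<and> x \<le> 4 \<and> \<mu> = of_real x)"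
  obtains z where "cmod z > 1" "2 - \<mu> = z + inverse z"
proof -
  define \<tau> where "\<tau> = 2 - \<mu>"
  define z where "z = (\<tau> + csqrt (\<tau>\<^sup>2 - 4)) / 2"
  have "2 * z - \<tau> = csqrt (\<tau>\<^sup>2 - 4)" by (simp add: z_def field_simps)
  then have "(2 * z - \<tau>)\<^sup>2 = \<tau>\<^sup>2 - 4" by simp
  moreover have "4 * (z * (\<tau> - z)) = \<tau>\<^sup>2 - (2 * z - \<tau>)\<^sup>2"
    by (simp add: power2_eq_square algebra_simps)
  ultimately have quad: "z * (\<tau> - z) = 1" by simp
  then have z0: "z \<noteq> 0" by auto
  then have \<tau>: "\<tau> = z + inverse z" using quad by (simp add: field_simps)
  have "cmod z \<noteq> 1"
  proof
    assume z1: "cmod z = 1"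
    then have "z * cnj z = 1" by (simp add: complex_norm_square[symmetric])
    then have "inverse z = cnj z" using z0 by (simp add: field_simps)
    then have "\<mu> = of_real (2 - 2 * Re z)"
      using \<tau> by (simp add: \<tau>_def complex_eq_iff)
    moreover have "\<bar>Re z\<bar> \<le> 1" using abs_Re_le_cmod[of z] z1 by simp
    then have "0 \<le> 2 - 2 * Re z" "2 - 2 * Re z \<le> 4" by linarith+
    ultimately show False using assms by blast
  qed
  then consider "cmod z > 1" | "cmod z < 1" by linarith
  then show ?thesis
  proof cases
    case 1
    then show ?thesis using that[of z] \<tau> by (simp add: \<tau>_def)
  next
    case 2
    then have "cmod (inverse z) > 1" using z0 by (simp add: norm_inverse one_less_inverse)
    then show ?thesis using that[of "inverse z"] \<tau> by (simp add: \<tau>_def add.commute)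
  qed
qed

text \<open>Off the spectral interval the solution \<open>z ^ k - inverse z ^ k\<close> grows like \<open>R ^ k\<close> with \<open>R > 1\<close>.
  The geometric sums in the Green function are then dominated by their last terms, and their
  products with the mirrored solution are of the same order \<open>R ^ N\<close> as the denominator: the inverse
  is bounded uniformly in \<open>N\<close>.\<close>

lemma stable_shifted_lap_mat_outside:
  fixes \<mu> :: complex
  assumes "\<not> (\<exists>x::real. 0 \<le> x \<and> x \<le> 4 \<and> \<mu> = of_real x)"
  shows "stable_relatively (\<lambda>N. poly_mat [:- \<mu>, 1:] (lap_mat N)) (\<lambda>_. 1)"
proof -
  obtain z where z: "cmod z > 1" and \<mu>: "2 - \<mu> = z + inverse z"
    using two_minus_eq_add_inverse[OF assms] .
  define R where "R = cmod z"
  define s where "s = (\<lambda>k::nat. z ^ k - inverse z ^ k)"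
  have R: "R > 1" and z0: "z \<noteq> 0" using z by (auto simp: R_def)
  have low: "R ^ k * (R - 1) / R \<le> cmod (s k)" if "1 \<le> k" for k
  proof -
    have "inverse R ^ k \<le> 1" using R by (simp add: power_le_one inverse_le_1_iff)
    moreover have "1 \<le> R ^ (k - 1)" using R by simp
    moreover have "R ^ k = R ^ (k - 1) * R" using that by (simp add: power_eq_if)
    then have "R ^ k * (R - 1) / R = R ^ k - R ^ (k - 1)" using R by (simp add: field_simps)
    moreover have "R ^ k - inverse R ^ k \<le> cmod (s k)"
      using norm_triangle_ineq2[of "z ^ k" "inverse z ^ k"]
      by (simp add: s_def R_def norm_power norm_inverse)
    ultimately show ?thesis by linarith
  qed
  have up: "cmod (s k) \<le> 2 * R ^ k" for k
  proof -
    have "inverse R ^ k \<le> 1" using R by (simp add: power_le_one inverse_le_1_iff)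
    moreover have "1 \<le> R ^ k" using R by simp
    moreover have "cmod (s k) \<le> R ^ k + inverse R ^ k"
      using norm_triangle_ineq4[of "z ^ k" "inverse z ^ k"]
      by (simp add: s_def R_def norm_power norm_inverse)
    ultimately show ?thesis by linarith
  qed
  have sum_le: "(\<Sum>i<m. cmod (s (i + 1))) \<le> 2 * R ^ (m + 1) / (R - 1)" for m
  proof (induction m)
    case (Suc m)
    have "2 * R ^ (m + 1) / (R - 1) + 2 * R ^ (m + 1) = 2 * R ^ (Suc m + 1) / (R - 1)"
      using R by (simp add: field_simps)
    then show ?case using Suc up[of "m + 1"] by simp
  qed (use R in simp)
  show ?thesis
  proof (rule stable_shifted_lap_mat)
    show "s 0 = 0" by (simp add: s_def)
    show nz: "s 1 \<noteq> 0" "s (N + 1) \<noteq> 0" for N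
    proof -
      have "0 < R ^ k * (R - 1) / R" for k using R by simp
      then have "0 < cmod (s k)" if "1 \<le> k" for k using low[OF that] by (meson less_le_trans)
      then show "s 1 \<noteq> 0" "s (N + 1) \<noteq> 0" by force+
    qed
    show "s (k + 2) = (2 - \<mu>) * s (k + 1) - s k" for k
      using z0 by (simp add: \<mu> s_def field_simps)
    \<comment> \<open>The quotient of the upper bound \<open>4 (R ^ (N + 2) + R ^ (N + 1)) / (R - 1)\<close> below by the lower bound
      for \<open>s (N + 1)\<close>.\<close>
    show "0 < 4 * (R + 1) * R / (R - 1)\<^sup>2" using R by simp
    fix N j :: nat assume j: "1 \<le> j" "j \<le> N"
    have "cmod (s (N + 1 - j)) * (\<Sum>i<j. cmod (s (i + 1))) + cmod (s j) * (\<Sum>i<N - j. cmod (s (i + 1)))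
        \<le> 2 * R ^ (N + 1 - j) * (2 * R ^ (j + 1) / (R - 1)) + 2 * R ^ j * (2 * R ^ (N - j + 1) / (R - 1))"
      using R by (intro add_mono mult_mono up sum_le sum_nonneg) auto
    also have "\<dots> = (4 * (R ^ (N + 1 - j) * R ^ (j + 1)) + 4 * (R ^ j * R ^ (N - j + 1))) / (R - 1)"
      by (simp add: add_divide_distrib)
    also have "R ^ (N + 1 - j) * R ^ (j + 1) = R ^ (N + 2)"
      using j by (simp flip: power_add)
    also have "R ^ j * R ^ (N - j + 1) = R ^ (N + 1)"
      using j by (simp flip: power_add)
    also have "(4 * R ^ (N + 2) + 4 * R ^ (N + 1)) / (R - 1)
        = 4 * (R + 1) * R / (R - 1)\<^sup>2 * 1 * (R ^ (N + 1) * (R - 1) / R)"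
      using R by (simp add: divide_simps power2_eq_square) (simp add: algebra_simps)
    also have "\<dots> \<le> 4 * (R + 1) * R / (R - 1)\<^sup>2 * 1 * cmod (s (N + 1))"
      using R by (intro mult_left_mono low) auto
    finally show "cmod (s (N + 1 - j)) * (\<Sum>i<j. cmod (s (i + 1)))
      + cmod (s j) * (\<Sum>i<N - j. cmod (s (i + 1))) \<le> \<dots>" .
  qed simp
qed

section \<open>Points of the spectral interval\<close>

text \<open>A weak form of Jordan's inequality, from the cubic Taylor bound: the factor \<open>1 - x\<^sup>2 / 6\<close> is at
  least \<open>1 / 3\<close> for \<open>\<bar>x\<bar> \<le> 2\<close>.\<close>

lemma abs_sin_ge_third:
  fixes x :: real
  assumes "\<bar>x\<bar> \<le> pi / 2"
  shows "\<bar>x\<bar> / 3 \<le> \<bar>sin x\<bar>"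
proof -
  have "\<bar>sin x - (\<Sum>m<3. sin_coeff m * x ^ m)\<bar> \<le> inverse (fact 3) * \<bar>x\<bar> ^ 3"
    by (rule Maclaurin_sin_bound)
  then have "\<bar>sin x - x\<bar> \<le> \<bar>x\<bar> ^ 3 / 6"
    by (simp add: eval_nat_numeral sin_coeff_def field_simps)
  moreover have "\<bar>x\<bar> ^ 3 \<le> 4 * \<bar>x\<bar>"
  proof -
    have "\<bar>x\<bar> \<le> 2" using assms pi_less_4 by linarith
    then have "\<bar>x\<bar> ^ 2 \<le> 2 ^ 2" by (intro power_mono) auto
    then have "\<bar>x\<bar> ^ 2 * \<bar>x\<bar> \<le> 4 * \<bar>x\<bar>" by (intro mult_right_mono) auto
    then show ?thesis by (simp add: power3_eq_cube power2_eq_square)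
  qed
  ultimately show ?thesis by linarith
qed

lemma abs_cos_diff_le:
  fixes a b :: real
  shows "\<bar>cos a - cos b\<bar> \<le> \<bar>a - b\<bar>"
proof -
  have "\<bar>cos a - cos b\<bar> = 2 * (\<bar>sin ((a + b) / 2)\<bar> * \<bar>sin ((b - a) / 2)\<bar>)"
    by (simp add: cos_diff_cos abs_mult)
  also have "\<dots> \<le> 2 * (1 * \<bar>(b - a) / 2\<bar>)"
    by (intro mult_left_mono mult_mono abs_sin_x_le_abs_x) auto
  finally show ?thesis by simp
qed

lemma abs_sin_minus_multiple_pi:
  fixes x :: real
  shows "\<bar>sin (x - of_int p * pi)\<bar> = \<bar>sin x\<bar>"
proof -
  have "sin (of_int p * pi) = 0" by (metis sin_npi_int mult.commute)
  moreover from this have "\<bar>cos (of_int p * pi)\<bar> = 1"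
    using sin_cos_squared_add[of "of_int p * pi"] by (auto simp: power2_eq_1_iff)
  ultimately show ?thesis by (simp add: sin_diff abs_mult)
qed

lemma four_sin_half_squared: "4 * (sin (pi / 2 * t))\<^sup>2 = 2 - 2 * cos (pi * t)"
  using cos_double_sin[of "pi / 2 * t"] by simp

text \<open>Up to a constant, \<open>\<bar>sin (n \<theta>)\<bar>\<close> is the distance from \<open>n \<theta>\<close> to the nearest multiple \<open>p \<pi>\<close>, that is,
  \<open>n\<close> times the distance from \<open>\<theta>\<close> to the grid point \<open>p \<pi> / n\<close>; and since the cosine is
  Lipschitz, the latter distance is at least half of the one between \<open>2 - 2 cos \<theta>\<close> and the eigenvalue
  belonging to \<open>p\<close>.  The hypothesis says nothing about \<open>p = 0\<close> and \<open>p = n\<close>.  There the distance is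
  at least \<open>\<theta>\<close> or \<open>\<pi> - \<theta>\<close>, and \<open>d \<le> 4\<close> suffices; this is why the constant depends on \<open>\<theta>\<close>.\<close>

lemma sin_multiple_lower_bound:
  fixes \<theta> :: real
  assumes \<theta>: "0 < \<theta>" "\<theta> < pi"
  shows "\<exists>K>0. \<forall>n\<ge>1. \<forall>d\<le>4. (\<forall>p. 1 \<le> p \<and> p \<le> n - 1 \<longrightarrow>
      d \<le> \<bar>2 - 2 * cos \<theta> - 4 * (sin (pi / 2 * (real p / real n)))\<^sup>2\<bar>)
    \<longrightarrow> real n * d \<le> K * \<bar>sin (real n * \<theta>)\<bar>"
proof (intro exI[of _ "6 + 12 / \<theta> + 12 / (pi - \<theta>)"] conjI allI impI)
  \<comment> \<open>Each term carries the \<open>3\<close> of the lower bound for the sine, times \<open>2\<close> for the Lipschitz estimate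
    or \<open>4\<close> for the upper bound of \<open>d\<close>.\<close>
  show "0 < 6 + 12 / \<theta> + 12 / (pi - \<theta>)" using \<theta> by (simp add: add_pos_pos)
  fix n :: nat and d :: real
  assume n: "1 \<le> n" and d4: "d \<le> 4"
    and d: "\<forall>p. 1 \<le> p \<and> p \<le> n - 1 \<longrightarrow>
      d \<le> \<bar>2 - 2 * cos \<theta> - 4 * (sin (pi / 2 * (real p / real n)))\<^sup>2\<bar>"
  define p where "p = round (real n * \<theta> / pi)"
  define e where "e = real n * \<theta> - of_int p * pi"
  have n0: "real n > 0" using n by simp
  have "\<bar>of_int p - real n * \<theta> / pi\<bar> \<le> 1 / 2" unfolding p_def by (rule of_int_round_abs_le)
  then have "\<bar>of_int p - real n * \<theta> / pi\<bar> * pi \<le> 1 / 2 * pi" by (intro mult_right_mono) auto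
  moreover have "\<bar>of_int p - real n * \<theta> / pi\<bar> * pi = \<bar>e\<bar>"
    by (simp add: e_def abs_mult_pos' field_simps abs_minus_commute flip: abs_mult_pos)
  ultimately have "\<bar>e\<bar> \<le> pi / 2" by simp
  then have "\<bar>e\<bar> / 3 \<le> \<bar>sin e\<bar>" by (rule abs_sin_ge_third)
  then have sin_ge: "\<bar>e\<bar> \<le> 3 * \<bar>sin (real n * \<theta>)\<bar>"
    using abs_sin_minus_multiple_pi[of "real n * \<theta>" p] by (simp add: e_def)
  have quot_pos: "0 < 12 / \<theta>" "0 < 12 / (pi - \<theta>)" using \<theta> by simp_all
  consider "p \<le> 0" | "p \<ge> int n" | "0 < p" "p < int n" by linarith
  then have "\<exists>c. c \<le> 6 + 12 / \<theta> + 12 / (pi - \<theta>) \<and> real n * d \<le> c * \<bar>sin (real n * \<theta>)\<bar>"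
  proof cases
    case 1
    then have "of_int p * pi \<le> 0" by (simp add: mult_nonpos_nonneg)
    then have "real n * \<theta> \<le> \<bar>e\<bar>" unfolding e_def by linarith
    then have "real n \<le> 3 * \<bar>sin (real n * \<theta>)\<bar> / \<theta>" using sin_ge \<theta> by (simp add: field_simps)
    moreover have "real n * d \<le> real n * 4" using d4 by (intro mult_left_mono) auto
    ultimately have "real n * d \<le> 12 / \<theta> * \<bar>sin (real n * \<theta>)\<bar>" by simp
    then show ?thesis using quot_pos by (intro exI[of _ "12 / \<theta>"] conjI) linarith+
  next
    case 2
    then have "real n \<le> of_int p" by linarith
    then have "real n * pi \<le> of_int p * pi" by (intro mult_right_mono) auto
    then have "real n * pi - real n * \<theta> \<le> \<bar>e\<bar>" unfolding e_def by linarith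
    then have "real n * (pi - \<theta>) \<le> \<bar>e\<bar>" by (simp only: right_diff_distrib)
    then have "real n \<le> 3 * \<bar>sin (real n * \<theta>)\<bar> / (pi - \<theta>)" using sin_ge \<theta> by (simp add: pos_le_divide_eq)
    moreover have "real n * d \<le> real n * 4" using d4 by (intro mult_left_mono) auto
    ultimately have "real n * d \<le> 12 / (pi - \<theta>) * \<bar>sin (real n * \<theta>)\<bar>" by simp
    then show ?thesis using quot_pos by (intro exI[of _ "12 / (pi - \<theta>)"] conjI) linarith+
  next
    case 3
    then have p: "of_int p = real (nat p)" "1 \<le> nat p" "nat p \<le> n - 1" by auto
    have "d \<le> \<bar>2 - 2 * cos \<theta> - 4 * (sin (pi / 2 * (real (nat p) / real n)))\<^sup>2\<bar>" using d p by blast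
    also have "\<dots> = 2 * \<bar>cos \<theta> - cos (pi * (real (nat p) / real n))\<bar>"
    proof -
      have "\<bar>2 - 2 * a - (2 - 2 * b)\<bar> = 2 * \<bar>a - b\<bar>" for a b :: real
        by (simp add: abs_if)
      then show ?thesis unfolding four_sin_half_squared .
    qed
    also have "\<dots> \<le> 2 * \<bar>\<theta> - pi * (real (nat p) / real n)\<bar>"
      using abs_cos_diff_le by (intro mult_left_mono) auto
    finally have "real n * d \<le> real n * (2 * \<bar>\<theta> - pi * (real (nat p) / real n)\<bar>)"
      by (intro mult_left_mono) auto
    also have "\<dots> = 2 * \<bar>real n * (\<theta> - pi * (real (nat p) / real n))\<bar>"
      by (simp add: abs_mult)
    also have "real n * (\<theta> - pi * (real (nat p) / real n)) = e"
      unfolding e_def p(1) right_diff_distrib using n0 by simp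
    finally have "real n * d \<le> 6 * \<bar>sin (real n * \<theta>)\<bar>" using sin_ge by linarith
    then show ?thesis using quot_pos by (intro exI[of _ 6] conjI) linarith+
  qed
  then obtain c where "c \<le> 6 + 12 / \<theta> + 12 / (pi - \<theta>)" "real n * d \<le> c * \<bar>sin (real n * \<theta>)\<bar>"
    by blast
  then show "real n * d \<le> (6 + 12 / \<theta> + 12 / (pi - \<theta>)) * \<bar>sin (real n * \<theta>)\<bar>"
    by (meson mult_right_mono abs_ge_zero order.trans)
qed

text \<open>In the interior the solution \<open>sin (k \<theta>)\<close> is bounded, so the Green function has row sums of order
  at most \<open>N / \<bar>sin ((N + 1) \<theta>)\<bar>\<close>, and the preceding lower bound cancels the factor \<open>N\<close>.\<close>

lemma stable_shifted_lap_mat_interior: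
  fixes x :: real and \<delta> :: "nat \<Rightarrow> real"
  assumes x: "0 < x" "x < 4" and pos: "\<And>N. 1 \<le> N \<Longrightarrow> 0 < \<delta> (N + 1)"
    and le4: "\<And>N. 1 \<le> N \<Longrightarrow> \<delta> (N + 1) \<le> 4"
    and le: "\<And>N p. 1 \<le> N \<Longrightarrow> 1 \<le> p \<Longrightarrow> p \<le> N \<Longrightarrow>
      \<delta> (N + 1) \<le> \<bar>x - 4 * (sin (pi / 2 * (real p / real (N + 1))))\<^sup>2\<bar>"
  shows "stable_relatively (\<lambda>N. poly_mat [:- complex_of_real x, 1:] (lap_mat N)) (\<lambda>N. 1 / \<delta> (N + 1))"
proof -
  define \<theta> where "\<theta> = arccos (1 - x / 2)"
  have \<theta>: "0 < \<theta>" "\<theta> < pi"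
    using x arccos_lt_bounded[of "1 - x / 2"] by (auto simp: \<theta>_def)
  have "cos \<theta> = 1 - x / 2" using x by (simp add: \<theta>_def)
  then have x_eq: "x = 2 - 2 * cos \<theta>" by simp
  obtain K where K: "K > 0"
    and sin_ge: "\<And>N. 1 \<le> N \<Longrightarrow> real (N + 1) * \<delta> (N + 1) \<le> K * \<bar>sin (real (N + 1) * \<theta>)\<bar>"
  proof -
    obtain K where K: "K > 0" and *: "\<forall>n\<ge>1. \<forall>d\<le>4. (\<forall>p. 1 \<le> p \<and> p \<le> n - 1 \<longrightarrow>
      d \<le> \<bar>2 - 2 * cos \<theta> - 4 * (sin (pi / 2 * (real p / real n)))\<^sup>2\<bar>)
      \<longrightarrow> real n * d \<le> K * \<bar>sin (real n * \<theta>)\<bar>"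
      using sin_multiple_lower_bound[OF \<theta>] by blast
    show ?thesis
    proof (rule that[OF K])
      fix N :: nat assume N: "1 \<le> N"
      have "\<forall>p. 1 \<le> p \<and> p \<le> N + 1 - 1 \<longrightarrow>
          \<delta> (N + 1) \<le> \<bar>2 - 2 * cos \<theta> - 4 * (sin (pi / 2 * (real p / real (N + 1))))\<^sup>2\<bar>"
        using le[OF N] unfolding x_eq by simp
      then show "real (N + 1) * \<delta> (N + 1) \<le> K * \<bar>sin (real (N + 1) * \<theta>)\<bar>"
        using *[rule_format, of "N + 1" "\<delta> (N + 1)"] le4[OF N] by simp
    qed
  qed
  define s where "s = (\<lambda>k. complex_of_real (sin (real k * \<theta>)))"
  show ?thesis
  proof (rule stable_shifted_lap_mat_bounded[where M = "\<lambda>_. 1" and s = s and K = K])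
    show "s 0 = 0" by (simp add: s_def)
    show "s 1 \<noteq> 0" using sin_gt_zero[OF \<theta>] by (simp add: s_def)
    show "s (k + 2) = (2 - complex_of_real x) * s (k + 1) - s k" for k
    proof -
      have "sin (real (k + 2) * \<theta>) + sin (real k * \<theta>) = 2 * cos \<theta> * sin (real (k + 1) * \<theta>)"
        using sin_add[of "real (k + 1) * \<theta>" \<theta>] sin_diff[of "real (k + 1) * \<theta>" \<theta>]
        by (simp add: algebra_simps)
      then have "sin (real (k + 2) * \<theta>) = (2 - x) * sin (real (k + 1) * \<theta>) - sin (real k * \<theta>)"
        by (simp add: x_eq)
      then show ?thesis by (simp only: s_def of_real_diff of_real_mult) simp
    qed
    show "0 < 1 / \<delta> (N + 1)" if "1 \<le> N" for N using pos[OF that] by simp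
    show "K > 0" by (rule K)
    show "s (N + 1) \<noteq> 0" if "1 \<le> N" for N
    proof -
      have "0 < real (N + 1) * \<delta> (N + 1)" using pos[OF that] by (intro mult_pos_pos) auto
      then have "sin (real (N + 1) * \<theta>) \<noteq> 0" using sin_ge[OF that] by (intro notI) simp
      then show ?thesis by (simp add: s_def del: of_nat_add)
    qed
    show "cmod (s k) \<le> 1" for k by (simp add: s_def)
    show "real N * 1\<^sup>2 \<le> K * (1 / \<delta> (N + 1)) * cmod (s (N + 1))" if "1 \<le> N" for N
    proof -
      have "real N \<le> real (N + 1)" by simp
      also have "\<dots> \<le> K * \<bar>sin (real (N + 1) * \<theta>)\<bar> / \<delta> (N + 1)"
        using sin_ge[OF that] pos[OF that] by (simp add: pos_le_divide_eq)
      finally show ?thesis by (simp add: s_def)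
    qed
  qed
qed

text \<open>At the end point \<open>0\<close> the solution is \<open>k\<close> and the inverse has norm of order \<open>N\<^sup>2\<close>.  This is within
  the rate because the smallest eigenvalue is at distance at most \<open>\<pi>\<^sup>2 / (N + 1)\<^sup>2\<close> from \<open>0\<close>.\<close>

lemma stable_shifted_lap_mat_0:
  fixes \<delta> :: "nat \<Rightarrow> real"
  assumes pos: "\<And>N. 1 \<le> N \<Longrightarrow> 0 < \<delta> (N + 1)"
    and le: "\<And>N. 1 \<le> N \<Longrightarrow> \<delta> (N + 1) \<le> 4 * (sin (pi / 2 * (1 / real (N + 1))))\<^sup>2"
  shows "stable_relatively (\<lambda>N. poly_mat [:0, 1:] (lap_mat N)) (\<lambda>N. 1 / \<delta> (N + 1))"
proof -
  have "stable_relatively (\<lambda>N. poly_mat [:- 0, 1:] (lap_mat N)) (\<lambda>N. 1 / \<delta> (N + 1))"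
  proof (rule stable_shifted_lap_mat_bounded[where M = real and s = of_nat and K = "pi\<^sup>2"])
    fix N :: nat assume N: "1 \<le> N"
    let ?n = "real (N + 1)"
    have n0: "?n > 0" by simp
    have "(sin (pi / 2 * (1 / ?n)))\<^sup>2 \<le> (pi / 2 * (1 / ?n))\<^sup>2"
      using abs_sin_x_le_abs_x[of "pi / 2 * (1 / ?n)"] by (simp only: abs_le_square_iff)
    then have "\<delta> (N + 1) \<le> 4 * (pi / 2 * (1 / ?n))\<^sup>2" using le[OF N] by linarith
    also have "\<dots> = pi\<^sup>2 / ?n\<^sup>2" by (simp only: power_mult_distrib power_divide) simp
    finally have "\<delta> (N + 1) * ?n\<^sup>2 \<le> pi\<^sup>2" using n0 by (simp add: pos_le_divide_eq)
    then have "?n\<^sup>2 \<le> pi\<^sup>2 * (1 / \<delta> (N + 1))" using pos[OF N] by (simp add: field_simps)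
    then have "?n * ?n\<^sup>2 \<le> ?n * (pi\<^sup>2 * (1 / \<delta> (N + 1)))" using n0 by (intro mult_left_mono) auto
    moreover have "real N * (real N)\<^sup>2 \<le> ?n * ?n\<^sup>2"
      by (intro mult_mono power_mono) auto
    ultimately show "real N * (real N)\<^sup>2 \<le> pi\<^sup>2 * (1 / \<delta> (N + 1)) * cmod (of_nat (N + 1))"
      by (simp only: norm_of_nat) (simp only: mult_ac)
    show "complex_of_nat (N + 1) \<noteq> 0" by (simp only: of_nat_eq_0_iff)
  qed (use pos in \<open>auto simp: algebra_simps\<close>)
  then show ?thesis by simp
qed

section \<open>Products of stable sequences\<close>

lemma stable_poly_mat_const:
  assumes "c \<noteq> 0" and "0 < e" and e: "\<And>N. 1 \<le> N \<Longrightarrow> e \<le> \<eta> N"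
  shows "stable_relatively (\<lambda>N. poly_mat [:c:] (lap_mat N)) \<eta>"
  unfolding stable_relatively_def
proof (intro conjI allI impI exI ballI)
  show "0 < e * cmod c" using assms by simp
  fix N :: nat and v :: "complex vec" assume N: "1 \<le> N" and v: "v \<in> carrier_vec N"
  have "e * (cmod c * max_norm_vec v) \<le> \<eta> N * (cmod c * max_norm_vec v)"
    using e[OF N] by (intro mult_right_mono) (auto simp: max_norm_vec_nonneg)
  then show "e * cmod c * max_norm_vec v
      \<le> \<eta> N * max_norm_vec (poly_mat [:c:] (lap_mat N) *\<^sub>v v)"
    by (simp add: poly_mat_const_mult_vec[OF lap_mat_carrier v] max_norm_vec_smult mult.assoc)
next
  fix N :: nat assume "1 \<le> N"
  then show "0 < \<eta> N" using e[of N] \<open>0 < e\<close> by simp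
qed simp

lemma stable_poly_mat_mult:
  assumes F: "stable_relatively (\<lambda>N. poly_mat F (lap_mat N)) (\<lambda>_. 1)"
    and G: "stable_relatively (\<lambda>N. poly_mat G (lap_mat N)) \<eta>"
  shows "stable_relatively (\<lambda>N. poly_mat (F * G) (lap_mat N)) \<eta>"
proof -
  obtain a where a: "a > 0" and F: "\<And>N v. 1 \<le> N \<Longrightarrow> v \<in> carrier_vec N \<Longrightarrow>
      a * max_norm_vec v \<le> max_norm_vec (poly_mat F (lap_mat N) *\<^sub>v v)"
    using F unfolding stable_relatively_def by auto
  obtain b where b: "b > 0" and G: "\<And>N v. 1 \<le> N \<Longrightarrow> v \<in> carrier_vec N \<Longrightarrow>
      b * max_norm_vec v \<le> \<eta> N * max_norm_vec (poly_mat G (lap_mat N) *\<^sub>v v)"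
    and \<eta>: "\<And>N. 1 \<le> N \<Longrightarrow> 0 < \<eta> N"
    using G unfolding stable_relatively_def by auto
  have "b * a * max_norm_vec v \<le> \<eta> N * max_norm_vec (poly_mat (F * G) (lap_mat N) *\<^sub>v v)"
    if N: "1 \<le> N" and v: "v \<in> carrier_vec N" for N v
  proof -
    let ?F = "poly_mat F (lap_mat N)"
    have Fv: "?F *\<^sub>v v \<in> carrier_vec N"
      by (rule mult_mat_vec_carrier[OF poly_mat_carrier[OF lap_mat_carrier] v])
    have "b * (a * max_norm_vec v) \<le> b * max_norm_vec (?F *\<^sub>v v)"
      using F[OF N v] b by (intro mult_left_mono) auto
    also note G[OF N Fv]
    finally show ?thesis
      unfolding mult.commute[of F G] poly_mat_mult_mult_vec[OF lap_mat_carrier v] by (simp add: mult.assoc)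
  qed
  then show ?thesis
    unfolding stable_relatively_def using \<eta> a b by (auto intro!: exI[of _ "b * a"])
qed

text \<open>Composing the two bounds would give the rate \<open>\<eta>\<^sup>2\<close>.  Instead, let \<open>L\<close> be the linear factor and
  \<open>Q = L h + Q(a)\<close>.  Then \<open>Q(a) v = Q(A) v - h(A) L(A) v\<close>, where \<open>Q(A) v\<close> is recovered from
  \<open>L(A) Q(A) v\<close> by the stability of \<open>L\<close> alone, and \<open>L(A) v\<close> by the stability of \<open>Q\<close> alone: the rate
  \<open>\<eta>\<close> enters only once in each summand.\<close>

lemma stable_poly_mat_mult_nonroot:
  assumes L: "stable_relatively (\<lambda>N. poly_mat [:- a, 1:] (lap_mat N)) \<eta>"
    and Q: "stable_relatively (\<lambda>N. poly_mat Q (lap_mat N)) \<eta>"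
    and nonroot: "poly Q a \<noteq> 0"
  shows "stable_relatively (\<lambda>N. poly_mat ([:- a, 1:] * Q) (lap_mat N)) \<eta>"
proof -
  let ?L = "[:- a, 1:]" and ?h = "- synthetic_div Q a" and ?c = "poly Q a"
  have bezout: "[:?c:] = Q + ?h * ?L"
  proof -
    have "C = R + - B * A" if "A * B + C = R" for A B C R :: "complex poly"
      using that by (auto simp: algebra_simps)
    then show ?thesis using synthetic_div_correct'[of a Q] by blast
  qed
  obtain l where l: "l > 0" and L: "\<And>N v. 1 \<le> N \<Longrightarrow> v \<in> carrier_vec N \<Longrightarrow>
      l * max_norm_vec v \<le> \<eta> N * max_norm_vec (poly_mat ?L (lap_mat N) *\<^sub>v v)"
    and \<eta>: "\<And>N. 1 \<le> N \<Longrightarrow> 0 < \<eta> N"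
    using L unfolding stable_relatively_def by auto
  obtain q where q: "q > 0" and Q: "\<And>N v. 1 \<le> N \<Longrightarrow> v \<in> carrier_vec N \<Longrightarrow>
      q * max_norm_vec v \<le> \<eta> N * max_norm_vec (poly_mat Q (lap_mat N) *\<^sub>v v)"
    using Q unfolding stable_relatively_def by auto
  obtain C where C: "C \<ge> 0" and h: "\<And>N v. v \<in> carrier_vec N \<Longrightarrow>
      max_norm_vec (poly_mat ?h (lap_mat N) *\<^sub>v v) \<le> C * max_norm_vec v"
    using poly_mat_lap_mat_bounded[of ?h] by blast
  define D where "D = inverse l + C * inverse q"
  have D: "D > 0" using l q C by (simp add: D_def add_pos_nonneg)
  have "cmod ?c / D * max_norm_vec v
      \<le> \<eta> N * max_norm_vec (poly_mat (?L * Q) (lap_mat N) *\<^sub>v v)"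
    if N: "1 \<le> N" and v: "v \<in> carrier_vec N" for N v
  proof -
    let ?A = "lap_mat N"
    let ?W = "max_norm_vec (poly_mat (?L * Q) ?A *\<^sub>v v)"
    have car: "poly_mat p ?A *\<^sub>v u \<in> carrier_vec N" if "u \<in> carrier_vec N" for p u
      by (rule mult_mat_vec_carrier[OF poly_mat_carrier[OF lap_mat_carrier] that])
    have "l * max_norm_vec (poly_mat Q ?A *\<^sub>v v) \<le> \<eta> N * ?W"
      using L[OF N car[OF v, of Q]] unfolding poly_mat_mult_mult_vec[OF lap_mat_carrier v] .
    then have Qv: "max_norm_vec (poly_mat Q ?A *\<^sub>v v) \<le> inverse l * (\<eta> N * ?W)"
      using l by (simp add: field_simps)
    have "q * max_norm_vec (poly_mat ?L ?A *\<^sub>v v) \<le> \<eta> N * ?W"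
      using Q[OF N car[OF v, of ?L]]
      unfolding mult.commute[of ?L Q] poly_mat_mult_mult_vec[OF lap_mat_carrier v] .
    then have Lv: "max_norm_vec (poly_mat ?L ?A *\<^sub>v v) \<le> inverse q * (\<eta> N * ?W)"
      using q by (simp add: field_simps)
    have "cmod ?c * max_norm_vec v = max_norm_vec (?c \<cdot>\<^sub>v v)" by (rule max_norm_vec_smult[symmetric])
    also have "?c \<cdot>\<^sub>v v = poly_mat Q ?A *\<^sub>v v + poly_mat ?h ?A *\<^sub>v (poly_mat ?L ?A *\<^sub>v v)"
      unfolding poly_mat_const_mult_vec[OF lap_mat_carrier v, symmetric] bezout
        poly_mat_add_mult_vec[OF lap_mat_carrier v] poly_mat_mult_mult_vec[OF lap_mat_carrier v] ..
    also have "max_norm_vec \<dots> \<le> max_norm_vec (poly_mat Q ?A *\<^sub>v v)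
        + max_norm_vec (poly_mat ?h ?A *\<^sub>v (poly_mat ?L ?A *\<^sub>v v))"
      by (rule max_norm_vec_add_le[OF car[OF v] car[OF car[OF v]]])
    also have "\<dots> \<le> inverse l * (\<eta> N * ?W) + C * (inverse q * (\<eta> N * ?W))"
      by (intro add_mono Qv order.trans[OF h[OF car[OF v]]] mult_left_mono Lv C)
    also have "\<dots> = D * (\<eta> N * ?W)" by (simp add: D_def algebra_simps)
    finally show ?thesis using D by (simp add: field_simps)
  qed
  then show ?thesis
    unfolding stable_relatively_def using \<eta> D nonroot
    by (auto intro!: exI[of _ "cmod ?c / D"])
qed

text \<open>Roots are split off one at a time.  A root off the interval costs a constant, hence its
  multiplicity is harmless; a root in the interval is simple, so it is not a root of the remaining
  factor and the Bezout argument applies.  The lower bound on the rate is what the constant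
  polynomials require.\<close>

lemma stable_poly_mat_simple_roots:
  fixes P :: "complex poly"
  assumes e: "0 < e" "\<And>N. 1 \<le> N \<Longrightarrow> e \<le> \<eta> N"
  shows "P \<noteq> 0 \<Longrightarrow>
    (\<And>x. 0 \<le> x \<Longrightarrow> x \<le> 4 \<Longrightarrow> poly P (complex_of_real x) = 0 \<Longrightarrow>
      Polynomial.order (complex_of_real x) P = 1 \<and>
      stable_relatively (\<lambda>N. poly_mat [:- complex_of_real x, 1:] (lap_mat N)) \<eta>) \<Longrightarrow>
    stable_relatively (\<lambda>N. poly_mat P (lap_mat N)) \<eta>"
proof (induction "degree P" arbitrary: P)
  case 0
  then obtain c where "P = [:c:]" by (metis degree_eq_zeroE)
  then show ?case using 0 stable_poly_mat_const[OF _ e] by simp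
next
  case (Suc n)
  have "\<not> constant (poly P)" using Suc.hyps(2) by (simp add: constant_degree)
  then obtain a where "poly P a = 0" using fundamental_theorem_of_algebra by blast
  then obtain Q where P: "P = [:- a, 1:] * Q" using poly_eq_0_iff_dvd by blast
  have nz: "[:- a, 1:] * Q \<noteq> 0" using Suc.prems(1) P by blast
  then have Q0: "Q \<noteq> 0" by force
  have "degree P = Suc (degree Q)" unfolding P using Q0 by (subst degree_mult_eq) auto
  then have degQ: "n = degree Q" using Suc.hyps(2) by simp
  have ord: "Polynomial.order b P = Polynomial.order b [:- a, 1:] + Polynomial.order b Q" for b
    unfolding P by (rule order_mult[OF nz])
  have stable_Q: "stable_relatively (\<lambda>N. poly_mat Q (lap_mat N)) \<eta>"
  proof (rule Suc.hyps(1)[OF degQ Q0])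
    fix x :: real assume x: "0 \<le> x" "x \<le> 4" "poly Q (complex_of_real x) = 0"
    then have root: "poly P (complex_of_real x) = 0" by (simp add: P)
    have "Polynomial.order (complex_of_real x) Q \<noteq> 0" using x(3) Q0 by (simp add: order_root)
    then show "Polynomial.order (complex_of_real x) Q = 1 \<and>
        stable_relatively (\<lambda>N. poly_mat [:- complex_of_real x, 1:] (lap_mat N)) \<eta>"
      using Suc.prems(2)[OF x(1,2) root] ord[of "complex_of_real x"] by auto
  qed
  show ?case
  proof (cases "\<exists>x::real. 0 \<le> x \<and> x \<le> 4 \<and> a = of_real x")
    case True
    then obtain x where x: "0 \<le> x" "x \<le> 4" "a = of_real x" by blast
    then have "Polynomial.order a P = 1"
      and stable_L: "stable_relatively (\<lambda>N. poly_mat [:- a, 1:] (lap_mat N)) \<eta>"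
      using Suc.prems(2) \<open>poly P a = 0\<close> by auto
    moreover have "Polynomial.order a [:- a, 1:] = 1"
      using order_power_n_n[of a 1] by simp
    ultimately have "Polynomial.order a Q = 0" using ord[of a] by simp
    then have "poly Q a \<noteq> 0" using Q0 by (simp add: order_root)
    then show ?thesis unfolding P by (rule stable_poly_mat_mult_nonroot[OF stable_L stable_Q])
  next
    case False
    then show ?thesis
      unfolding P by (intro stable_poly_mat_mult stable_shifted_lap_mat_outside stable_Q)
  qed
qed

theorem theorem4p3:
  fixes P :: "complex poly"
    and \<Lambda> :: "real set"
    and \<delta> :: "nat \<Rightarrow> real"
  assumes roots: "\<Lambda> = {x::real. 0 \<le> x \<and> x \<le> 4 \<and> poly P (complex_of_real x) = 0}"
    and zero_root: "0 \<in> \<Lambda>"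
    and four_not_root: "4 \<notin> \<Lambda>"
    and simple: "\<forall>x\<in>\<Lambda>. Polynomial.order (complex_of_real x) P = 1"
    and delta_pos: "\<forall>q\<ge>1. 0 < \<delta> q"
    and delta_le: "\<forall>x\<in>\<Lambda>. \<forall>q\<ge>1. \<forall>p. 1 \<le> p \<and> p \<le> q - 1 \<longrightarrow>
      0 < \<delta> q \<and> \<delta> q \<le> \<bar>x - 4 * (sin (pi / 2 * (real p / real q)))\<^sup>2\<bar>"
  shows "stable_relatively (\<lambda>N. poly_mat P (lap_mat N)) (\<lambda>N. 1 / \<delta> (N + 1))"
proof -
  have P0: "P \<noteq> 0" using four_not_root roots by auto
  have pos: "0 < \<delta> (N + 1)" for N using delta_pos by simp
  have le: "\<delta> (N + 1) \<le> \<bar>x - 4 * (sin (pi / 2 * (real p / real (N + 1))))\<^sup>2\<bar>"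
    if "x \<in> \<Lambda>" "1 \<le> p" "p \<le> N" for N p x
    using delta_le[rule_format, of x "N + 1" p] that by simp
  have le0: "\<delta> (N + 1) \<le> 4 * (sin (pi / 2 * (1 / real (N + 1))))\<^sup>2" if "1 \<le> N" for N
    using le[OF zero_root, of 1 N] that by simp
  have le4: "\<delta> (N + 1) \<le> 4" if "1 \<le> N" for N
  proof -
    have "(sin (pi / 2 * (1 / real (N + 1))))\<^sup>2 \<le> 1" by (simp only: abs_square_le_1 abs_sin_le_one)
    then show ?thesis using le0[OF that] by linarith
  qed
  show ?thesis
  proof (rule stable_poly_mat_simple_roots[OF _ _ P0])
    show "0 < 1 / (4::real)" by simp
    show "1 / 4 \<le> 1 / \<delta> (N + 1)" if "1 \<le> N" for N
      using pos le4[OF that] by (intro divide_left_mono) auto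
    fix x :: real assume x: "0 \<le> x" "x \<le> 4" "poly P (complex_of_real x) = 0"
    then have mem: "x \<in> \<Lambda>" by (simp add: roots)
    then have "x < 4" using four_not_root x(2) by (cases "x = 4") auto
    then have "stable_relatively (\<lambda>N. poly_mat [:- complex_of_real x, 1:] (lap_mat N)) (\<lambda>N. 1 / \<delta> (N + 1))"
      using x(1) stable_shifted_lap_mat_0[OF pos le0]
        stable_shifted_lap_mat_interior[OF _ _ pos le4 le[OF mem]]
      by (cases "x = 0") auto
    then show "Polynomial.order (complex_of_real x) P = 1 \<and>
        stable_relatively (\<lambda>N. poly_mat [:- complex_of_real x, 1:] (lap_mat N)) (\<lambda>N. 1 / \<delta> (N + 1))"
      using simple mem by blast
  qed
qed

end
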